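(* Let $n\ge 1$, let $g$ be the Semi-Riemannian metric on $GL_n=GL_n(\mathbb{R})$ given by $g_A(V,W)=\mathrm{tr}(A^{-1}VA^{-1}W)$ for $A\in GL_n$, $V,W\in T_A(GL_n)=M_n(\mathbb{R})$, and let $\nabla$ be the Levi-Civita connection of $(GL_n,g)$. Let $\mathcal{GL}_n$ be the Lie algebra of left-invariant vector fields on $GL_n$. Then $$\nabla_XY=\tfrac12[X,Y]\in\mathcal{GL}_n$$ for any $X,Y\in\mathcal{GL}_n$. Hence $\nabla$ is the Cartan-Schouten $(0)$-connection of $GL_n$.
   Context: A left-invariant vector field $X$ on $GL_n(\mathbb{R})$ has the form $X_P=PX_0$ for all $P\in GL_n(\mathbb{R})$, with $X_0=X_{I_n}\in M_n(\mathbb{R})$; $[X,Y]$ is the bracket of vector fields. The Cartan-Schouten $(0)$-connection of a Lie group is the left-invariant affine connection determined by $\nabla_XY=\frac12[X,Y]$ for all left-invariant vector fields $X,Y$. *)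

theory Defs
  imports "HOL-Analysis.Analysis"
begin

section \<open>Smooth maps and vector fields on open subsets of a Euclidean space\<close>

text \<open>
  The definitions below are meant for an open set \<open>U\<close> of a Euclidean space, regarded as a manifold
  with \<open>T\<^sub>p U\<close> identified with the ambient space. Functions and vector fields on \<open>U\<close> are represented by
  total functions; their values outside \<open>U\<close> carry no meaning, and two fields are the same
  if they agree on \<open>U\<close>.
\<close>

primrec k_smooth_on :: "nat \<Rightarrow> 'a::real_normed_vector set \<Rightarrow> ('a \<Rightarrow> 'b::real_normed_vector) \<Rightarrow> bool"
  where
    "k_smooth_on 0 U f \<longleftrightarrow> continuous_on U f"
  | "k_smooth_on (Suc k) U f \<longleftrightarrow>
       (\<forall>p\<in>U. f differentiable (at p)) \<and>
       (\<forall>v. k_smooth_on k U (\<lambda>p. frechet_derivative f (at p) v))"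

definition smooth_on :: "'a::real_normed_vector set \<Rightarrow> ('a \<Rightarrow> 'b::real_normed_vector) \<Rightarrow> bool"
  where "smooth_on U f \<longleftrightarrow> (\<forall>k. k_smooth_on k U f)"

definition vector_fields :: "'a::euclidean_space set \<Rightarrow> ('a \<Rightarrow> 'a) set"
  where "vector_fields U = {X. smooth_on U X}"

text \<open>The derivative of \<open>f\<close> along \<open>X\<close>; for real-valued \<open>f\<close> this is the function \<open>X f\<close>.\<close>

definition field_deriv ::
    "('a::real_normed_vector \<Rightarrow> 'a) \<Rightarrow> ('a \<Rightarrow> 'b::real_normed_vector) \<Rightarrow> 'a \<Rightarrow> 'b"
  where "field_deriv X f p = frechet_derivative f (at p) (X p)"

text \<open>
  The bracket \<open>[X, Y] f = X (Y f) - Y (X f)\<close>, in the coordinates of the ambient space.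
\<close>

definition lie_bracket ::
    "('a::euclidean_space \<Rightarrow> 'a) \<Rightarrow> ('a \<Rightarrow> 'a) \<Rightarrow> 'a \<Rightarrow> 'a"
  where "lie_bracket X Y p = field_deriv X Y p - field_deriv Y X p"


section \<open>Semi-Riemannian metrics and connections\<close>

text \<open>The largest dimension of a subspace on which the symmetric form \<open>b\<close> is negative definite.\<close>

definition form_index :: "('a::euclidean_space \<Rightarrow> 'a \<Rightarrow> real) \<Rightarrow> nat"
  where "form_index b = Max {dim S | S. subspace S \<and> (\<forall>v\<in>S. v \<noteq> 0 \<longrightarrow> b v v < 0)}"

definition semi_riemannian_metric_on ::
    "'a::euclidean_space set \<Rightarrow> ('a \<Rightarrow> 'a \<Rightarrow> 'a \<Rightarrow> real) \<Rightarrow> bool"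
  where "semi_riemannian_metric_on U g \<longleftrightarrow>
    (\<forall>v w. smooth_on U (\<lambda>p. g p v w)) \<and>
    (\<forall>p\<in>U. bilinear (g p) \<and> (\<forall>v w. g p v w = g p w v) \<and>
           (\<forall>v. (\<forall>w. g p v w = 0) \<longrightarrow> v = 0)) \<and>
    (\<exists>\<nu>. \<forall>p\<in>U. form_index (g p) = \<nu>)"

type_synonym 'a connection = "('a \<Rightarrow> 'a) \<Rightarrow> ('a \<Rightarrow> 'a) \<Rightarrow> 'a \<Rightarrow> 'a"

text \<open>
  In \<^term>\<open>nabla X Y\<close> the field \<^term>\<open>X\<close> is the direction of differentiation. Dependence of
  \<^term>\<open>nabla X Y\<close> only on the restrictions of \<^term>\<open>X\<close> and \<^term>\<open>Y\<close> to \<^term>\<open>U\<close> is not a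
  separate axiom: take \<^term>\<open>f\<close> to be the indicator function of \<^term>\<open>U\<close> in the second and
  fourth clauses.
\<close>

definition affine_connection_on :: "'a::euclidean_space set \<Rightarrow> 'a connection \<Rightarrow> bool"
  where "affine_connection_on U nabla \<longleftrightarrow>
    (\<forall>X\<in>vector_fields U. \<forall>Y\<in>vector_fields U. nabla X Y \<in> vector_fields U) \<and>
    (\<forall>f h :: 'a \<Rightarrow> real. \<forall>X\<in>vector_fields U. \<forall>X'\<in>vector_fields U. \<forall>Y\<in>vector_fields U.
       smooth_on U f \<longrightarrow> smooth_on U h \<longrightarrow>
       (\<forall>p\<in>U. nabla (\<lambda>q. f q *\<^sub>R X q + h q *\<^sub>R X' q) Y p
               = f p *\<^sub>R nabla X Y p + h p *\<^sub>R nabla X' Y p)) \<and>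
    (\<forall>a b :: real. \<forall>X\<in>vector_fields U. \<forall>Y\<in>vector_fields U. \<forall>Y'\<in>vector_fields U.
       \<forall>p\<in>U. nabla X (\<lambda>q. a *\<^sub>R Y q + b *\<^sub>R Y' q) p = a *\<^sub>R nabla X Y p + b *\<^sub>R nabla X Y' p) \<and>
    (\<forall>f :: 'a \<Rightarrow> real. \<forall>X\<in>vector_fields U. \<forall>Y\<in>vector_fields U. smooth_on U f \<longrightarrow>
       (\<forall>p\<in>U. nabla X (\<lambda>q. f q *\<^sub>R Y q) p = field_deriv X f p *\<^sub>R Y p + f p *\<^sub>R nabla X Y p))"

definition torsion_free_on :: "'a::euclidean_space set \<Rightarrow> 'a connection \<Rightarrow> bool"
  where "torsion_free_on U nabla \<longleftrightarrow>
    (\<forall>X\<in>vector_fields U. \<forall>Y\<in>vector_fields U. \<forall>p\<in>U.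
       nabla X Y p - nabla Y X p = lie_bracket X Y p)"

definition metric_compatible_on ::
    "'a::euclidean_space set \<Rightarrow> ('a \<Rightarrow> 'a \<Rightarrow> 'a \<Rightarrow> real) \<Rightarrow> 'a connection \<Rightarrow> bool"
  where "metric_compatible_on U g nabla \<longleftrightarrow>
    (\<forall>X\<in>vector_fields U. \<forall>Y\<in>vector_fields U. \<forall>Z\<in>vector_fields U. \<forall>p\<in>U.
       field_deriv X (\<lambda>q. g q (Y q) (Z q)) p = g p (nabla X Y p) (Z p) + g p (Y p) (nabla X Z p))"

definition levi_civita_connection_on ::
    "'a::euclidean_space set \<Rightarrow> ('a \<Rightarrow> 'a \<Rightarrow> 'a \<Rightarrow> real) \<Rightarrow> 'a connection \<Rightarrow> bool"
  where "levi_civita_connection_on U g nabla \<longleftrightarrow>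
    affine_connection_on U nabla \<and> torsion_free_on U nabla \<and> metric_compatible_on U g nabla"


section \<open>The general linear group\<close>

definition GL :: "(real^'n^'n) set"
  where "GL = {A. invertible A}"

definition gl_metric :: "real^'n^'n \<Rightarrow> real^'n^'n \<Rightarrow> real^'n^'n \<Rightarrow> real"
  where "gl_metric A V W = trace (matrix_inv A ** V ** matrix_inv A ** W)"

definition left_invariant_fields :: "(real^'n^'n \<Rightarrow> real^'n^'n) set"
  where "left_invariant_fields = {X. \<forall>P\<in>GL. X P = P ** X (mat 1)}"

text \<open>
  The push-forward of \<open>X\<close> by the left translation \<open>P \<mapsto> B P\<close>, a linear map and hence its own
  differential.
\<close>

definition left_push :: "real^'n^'n \<Rightarrow> (real^'n^'n \<Rightarrow> real^'n^'n) \<Rightarrow> real^'n^'n \<Rightarrow> real^'n^'n"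
  where "left_push B X P = B ** X (matrix_inv B ** P)"

definition left_invariant_connection :: "(real^'n^'n) connection \<Rightarrow> bool"
  where "left_invariant_connection nabla \<longleftrightarrow>
    (\<forall>B\<in>GL. \<forall>X\<in>vector_fields GL. \<forall>Y\<in>vector_fields GL. \<forall>P\<in>GL.
       nabla (left_push B X) (left_push B Y) P = left_push B (nabla X Y) P)"

text \<open>The Cartan-Schouten (0)-connection of the Lie group \<^term>\<open>GL\<close>.\<close>

definition cartan_schouten_zero_connection :: "(real^'n^'n) connection \<Rightarrow> bool"
  where "cartan_schouten_zero_connection nabla \<longleftrightarrow>
    affine_connection_on GL nabla \<and> left_invariant_connection nabla \<and>
    (\<forall>X\<in>left_invariant_fields. \<forall>Y\<in>left_invariant_fields. \<forall>P\<in>GL.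
       nabla X Y P = (1/2) *\<^sub>R lie_bracket X Y P)"


section \<open>The metric on the general linear group is semi-Riemannian and has a Levi-Civita connection\<close>

subsection \<open>Smooth maps\<close>

lemma k_smooth_on_cong:
  assumes "open U" "\<And>p. p \<in> U \<Longrightarrow> f p = g p" "k_smooth_on k U f"
  shows "k_smooth_on k U g"
  using assms
proof (induction k arbitrary: f g)
  case 0
  then show ?case by (metis continuous_on_cong k_smooth_on.simps(1))
next
  case (Suc k)
  have 1: "g differentiable (at p)" and 2: "frechet_derivative g (at p) = frechet_derivative f (at p)"
    if "p \<in> U" for p
  proof -
    have "f differentiable (at p)" using Suc that by auto
    then have "(f has_derivative frechet_derivative f (at p)) (at p)"
      using frechet_derivative_works by blast
    then have "(g has_derivative frechet_derivative f (at p)) (at p)"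
      by (rule has_derivative_transform_within_open) (use Suc that in auto)
    then show "g differentiable (at p)" "frechet_derivative g (at p) = frechet_derivative f (at p)"
      by (auto simp: differentiable_def frechet_derivative_at[symmetric])
  qed
  have "k_smooth_on k U (\<lambda>p. frechet_derivative g (at p) v)" for v
    by (rule Suc.IH[of "\<lambda>p. frechet_derivative f (at p) v"]) (use Suc.prems 2 in auto)
  then show ?case using 1 by auto
qed

lemma k_smooth_on_SucI:
  assumes "open U" "\<And>p. p \<in> U \<Longrightarrow> (f has_derivative f' p) (at p)"
    and "\<And>v. k_smooth_on k U (\<lambda>p. f' p v)"
  shows "k_smooth_on (Suc k) U f"
proof -
  have eq: "frechet_derivative f (at p) = f' p" if "p \<in> U" for p
    using frechet_derivative_at[OF assms(2)[OF that]] by simp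
  have "k_smooth_on k U (\<lambda>p. frechet_derivative f (at p) v)" for v
    by (rule k_smooth_on_cong[OF assms(1) _ assms(3)[of v]]) (simp add: eq)
  then show ?thesis using assms(2) by (auto simp: differentiable_def)
qed

lemma k_smooth_on_Suc_D: "k_smooth_on (Suc k) U f \<Longrightarrow> k_smooth_on k U f"
proof (induction k arbitrary: f)
  case 0
  then have "continuous (at p within U) f" if "p \<in> U" for p
    using that differentiable_imp_continuous_within differentiable_at_withinI by fastforce
  then show ?case by (simp add: continuous_on_eq_continuous_within)
next
  case (Suc k)
  have "k_smooth_on k U (\<lambda>p. frechet_derivative f (at p) v)" for v
    using Suc.prems by (intro Suc.IH) (simp only: k_smooth_on.simps(2)[of "Suc k" U f])
  then show ?case using Suc.prems by (simp only: k_smooth_on.simps(2)) blast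
qed

lemma k_smooth_on_const: "open U \<Longrightarrow> k_smooth_on k U (\<lambda>p. c)"
proof (induction k arbitrary: c)
  case (Suc k)
  show ?case
    by (rule k_smooth_on_SucI[where f' = "\<lambda>p v. 0"]) (use Suc in auto)
qed auto

lemma k_smooth_on_add:
  "\<lbrakk>open U; k_smooth_on k U f; k_smooth_on k U g\<rbrakk> \<Longrightarrow> k_smooth_on k U (\<lambda>p. f p + g p)"
proof (induction k arbitrary: f g)
  case 0
  then show ?case by (auto intro: continuous_on_add)
next
  case (Suc k)
  show ?case
    by (rule k_smooth_on_SucI[where f' = "\<lambda>p v. frechet_derivative f (at p) v + frechet_derivative g (at p) v"])
      (use Suc in \<open>auto intro!: has_derivative_add simp: frechet_derivative_works[symmetric]\<close>)
qed

lemma k_smooth_on_bilinear: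
  assumes "bounded_bilinear B" "open U"
  shows "\<lbrakk>k_smooth_on k U f; k_smooth_on k U g\<rbrakk> \<Longrightarrow> k_smooth_on k U (\<lambda>p. B (f p) (g p))"
proof (induction k arbitrary: f g)
  case 0
  then show ?case using bounded_bilinear.continuous_on[OF assms(1)] by auto
next
  case (Suc k)
  let ?D = "\<lambda>p v. B (f p) (frechet_derivative g (at p) v) + B (frechet_derivative f (at p) v) (g p)"
  have f: "k_smooth_on k U f" and g: "k_smooth_on k U g"
    using Suc.prems by (auto dest: k_smooth_on_Suc_D simp del: k_smooth_on.simps)
  have "k_smooth_on k U (\<lambda>p. ?D p v)" for v
    by (rule k_smooth_on_add[OF assms(2) Suc.IH[OF f] Suc.IH[OF _ g]]) (use Suc.prems in auto)
  moreover have "((\<lambda>p. B (f p) (g p)) has_derivative ?D p) (at p)" if "p \<in> U" for p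
    by (rule bounded_bilinear.FDERIV[OF assms(1)])
      (use Suc.prems that in \<open>auto simp: frechet_derivative_works\<close>)
  ultimately show ?case by (intro k_smooth_on_SucI[OF assms(2)])
qed

lemma k_smooth_on_linear:
  assumes "bounded_linear h" "open U" "k_smooth_on k U f"
  shows "k_smooth_on k U (\<lambda>p. h (f p))"
  using assms(3)
proof (induction k arbitrary: f)
  case 0
  then show ?case using bounded_linear.continuous_on[OF assms(1)] by auto
next
  case (Suc k)
  then show ?case
    by (intro k_smooth_on_SucI[OF assms(2), where f' = "\<lambda>p v. h (frechet_derivative f (at p) v)"])
      (auto intro: bounded_linear.has_derivative[OF assms(1)] iffD1[OF frechet_derivative_works])
qed

lemma k_smooth_on_sum:
  assumes "open U" "\<And>i. i \<in> I \<Longrightarrow> k_smooth_on k U (f i)"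
  shows "k_smooth_on k U (\<lambda>p. \<Sum>i\<in>I. f i p)"
  using assms(2) by (induction I rule: infinite_finite_induct)
    (auto intro: k_smooth_on_const k_smooth_on_add \<open>open U\<close>)

lemma smooth_onD:
  assumes "smooth_on U f"
  shows "k_smooth_on k U f" "k_smooth_on k U (\<lambda>p. frechet_derivative f (at p) v)"
    "p \<in> U \<Longrightarrow> f differentiable (at p)"
proof -
  show "k_smooth_on k U f" using assms by (simp add: smooth_on_def)
  have "k_smooth_on (Suc k) U f" using assms unfolding smooth_on_def by (rule spec)
  then show "k_smooth_on k U (\<lambda>p. frechet_derivative f (at p) v)"
    "p \<in> U \<Longrightarrow> f differentiable (at p)" by simp_all
qed

lemma smooth_on_field_deriv:
  fixes X :: "'a::euclidean_space \<Rightarrow> 'a"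
  assumes "open U" "smooth_on U X" "smooth_on U f"
  shows "smooth_on U (field_deriv X f)"
  unfolding smooth_on_def
proof
  fix k
  have "k_smooth_on k U (\<lambda>p. \<Sum>b\<in>Basis. (X p \<bullet> b) *\<^sub>R frechet_derivative f (at p) b)"
  proof (intro k_smooth_on_sum assms k_smooth_on_bilinear[OF bounded_bilinear_scaleR])
    fix b :: 'a
    show "k_smooth_on k U (\<lambda>p. X p \<bullet> b)"
      using assms by (intro k_smooth_on_linear[OF bounded_linear_inner_left]) (auto simp: smooth_on_def)
    show "k_smooth_on k U (\<lambda>p. frechet_derivative f (at p) b)"
      by (rule smooth_onD[OF assms(3)])
  qed
  moreover have "(\<Sum>b\<in>Basis. (X p \<bullet> b) *\<^sub>R frechet_derivative f (at p) b) = field_deriv X f p"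
    if "p \<in> U" for p
  proof -
    have "f differentiable (at p)"
      by (rule smooth_onD[OF assms(3)]) (rule that)
    then have l: "linear (frechet_derivative f (at p))" by (rule linear_frechet_derivative)
    have "frechet_derivative f (at p) (X p) = frechet_derivative f (at p) (\<Sum>b\<in>Basis. (X p \<bullet> b) *\<^sub>R b)"
      by (simp add: euclidean_representation)
    also have "\<dots> = (\<Sum>b\<in>Basis. (X p \<bullet> b) *\<^sub>R frechet_derivative f (at p) b)"
      by (simp add: linear_sum[OF l] linear_scale[OF l])
    finally show ?thesis by (simp add: field_deriv_def)
  qed
  ultimately show "k_smooth_on k U (field_deriv X f)"
    by (rule k_smooth_on_cong[OF assms(1), rotated])
qed

subsection \<open>Smoothness of matrix inversion\<close>

lemma bounded_bilinear_mm:
  "bounded_bilinear ((**) :: real^'n^'n \<Rightarrow> real^'n^'n \<Rightarrow> real^'n^'n)"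
proof -
  have "bilinear ((**) :: real^'n^'n \<Rightarrow> real^'n^'n \<Rightarrow> real^'n^'n)"
    unfolding bilinear_def
    by (intro conjI allI linearI)
      (simp_all add: vec_eq_iff matrix_matrix_mult_def sum_distrib_left sum.distrib algebra_simps)
  then show ?thesis by (simp add: bilinear_conv_bounded_bilinear)
qed

lemma continuous_on_det: "continuous_on S f \<Longrightarrow> continuous_on S (\<lambda>x. det (f x :: real^'n^'n))"
  unfolding det_def by (intro continuous_intros)

lemma open_GL: "open (GL :: (real^'n^'n) set)"
proof -
  have "GL = (det -` (- {0}) :: (real^'n^'n) set)"
    by (auto simp: GL_def invertible_det_nz)
  then show ?thesis
    using open_vimage[OF open_Compl[OF closed_singleton[of "0::real"]] continuous_on_det[OF continuous_on_id]]
    by metis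
qed

lemma GL_inv:
  assumes "A \<in> GL"
  shows "A ** matrix_inv A = mat 1" "matrix_inv A ** A = mat 1"
  using assms matrix_inv_def[of A] someI_ex[of "\<lambda>A'. A ** A' = mat 1 \<and> A' ** A = mat 1"]
  unfolding GL_def invertible_def by auto

lemma matrix_inv_entry:
  assumes "(A :: real^'n^'n) \<in> GL"
  shows "matrix_inv A $ i $ j = det (\<chi> k l. if l = i then (if k = j then 1 else 0) else A $ k $ l) / det A"
proof -
  have d: "det A \<noteq> 0" using assms by (simp add: GL_def invertible_det_nz)
  have "A *v (matrix_inv A *v axis j 1) = axis j 1"
    by (simp add: matrix_vector_mul_assoc GL_inv[OF assms])
  then have "matrix_inv A *v axis j 1 = (\<chi> k. det (\<chi> i l. if l = k then axis j 1 $ i else A $ i $ l) / det A)"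
    using cramer[OF d] by blast
  moreover have "(matrix_inv A *v axis j 1) $ i = matrix_inv A $ i $ j"
    by (simp add: matrix_vector_mul_component inner_axis)
  moreover have "(axis j (1::real) :: real^'n) $ k = (if k = j then 1 else 0)" for k
    by (simp add: axis_def)
  ultimately show ?thesis by (simp only: vec_lambda_beta)
qed

lemma continuous_on_matrix_inv: "continuous_on GL (matrix_inv :: real^'n^'n \<Rightarrow> real^'n^'n)"
proof -
  have 1: "continuous_on GL (\<lambda>A :: real^'n^'n. if l = i then c else A $ k $ l)" for l i k c
    by (cases "l = i")
      (auto intro: continuous_on_const continuous_on_component[OF continuous_on_component[OF continuous_on_id]])
  have "continuous_on GL (\<lambda>A :: real^'n^'n. \<chi> i j.
     det ((\<chi> k l. if l = i then (if k = j then 1 else 0) else A $ k $ l) :: real^'n^'n) / det A)"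
    by (intro continuous_on_vec_lambda continuous_on_divide continuous_on_det 1 continuous_on_id)
      (auto simp: GL_def invertible_det_nz)
  then show ?thesis
    by (rule continuous_on_eq) (simp add: matrix_inv_entry vec_eq_iff)
qed

lemma mm_lin:
  fixes A B C :: "real^'n^'n"
  shows "(A + B) ** C = A ** C + B ** C" "(A - B) ** C = A ** C - B ** C"
    "A ** (B + C) = A ** B + A ** C" "A ** (B - C) = A ** B - A ** C"
    "(- A) ** B = - (A ** B)" "A ** (- B) = - (A ** B)"
    "(r *\<^sub>R A) ** B = r *\<^sub>R (A ** B)" "A ** (r *\<^sub>R B) = r *\<^sub>R (A ** B)"
  by (rule bounded_bilinear.add_left[OF bounded_bilinear_mm] bounded_bilinear.diff_left[OF bounded_bilinear_mm]
      bounded_bilinear.add_right[OF bounded_bilinear_mm] bounded_bilinear.diff_right[OF bounded_bilinear_mm]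
      bounded_bilinear.minus_left[OF bounded_bilinear_mm] bounded_bilinear.minus_right[OF bounded_bilinear_mm]
      bounded_bilinear.scaleR_left[OF bounded_bilinear_mm] bounded_bilinear.scaleR_right[OF bounded_bilinear_mm])+

lemma bounded_linear_mm:
  fixes A B :: "real^'n^'n"
  shows "bounded_linear (\<lambda>V::real^'n^'n. A ** V ** (B::real^'n^'n))"
  using bounded_linear_compose[OF bounded_bilinear.bounded_linear_left[OF bounded_bilinear_mm, of B]
      bounded_bilinear.bounded_linear_right[OF bounded_bilinear_mm, of A]] by simp

lemma bounded_linear_trace: "bounded_linear (trace :: real^'n^'n \<Rightarrow> real)"
  by (rule linear_conv_bounded_linear[THEN iffD1])
    (auto intro!: linearI simp: trace_def sum.distrib sum_distrib_left)

lemma has_derivative_matrix_inv: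
  fixes A :: "real^'n^'n"
  assumes A: "A \<in> GL"
  shows "(matrix_inv has_derivative (\<lambda>V. - (matrix_inv A ** V ** matrix_inv A))) (at A)"
proof -
  obtain K where K: "\<And>(a :: real^'n^'n) (b :: real^'n^'n). norm (a ** b) \<le> norm a * norm b * K" "K > 0"
    using bounded_bilinear.pos_bounded[OF bounded_bilinear_mm[where 'n = 'n]] by blast
  obtain e where e: "e > 0" "\<And>B. dist B A < e \<Longrightarrow> B \<in> GL"
    using open_GL A unfolding open_dist by blast
  define H where "H B = norm (matrix_inv A - matrix_inv B) * K * norm (matrix_inv A) * K" for B
  have eq: "matrix_inv B - matrix_inv A - - (matrix_inv A ** (B - A) ** matrix_inv A)
      = (matrix_inv A - matrix_inv B) ** (B - A) ** matrix_inv A" if "B \<in> GL" for B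
  proof -
    have "matrix_inv B ** A ** matrix_inv A = matrix_inv B" "matrix_inv A ** A ** matrix_inv A = matrix_inv A"
       "matrix_inv B ** B ** matrix_inv A = matrix_inv A"
      by (simp_all add: matrix_mul_assoc[symmetric] GL_inv[OF A])
        (simp add: matrix_mul_assoc GL_inv[OF that])
    then show ?thesis by (simp add: mm_lin matrix_mul_assoc)
  qed
  show ?thesis
  proof (rule has_derivativeI_sandwich[OF e(1)])
    show "bounded_linear (\<lambda>V. - (matrix_inv A ** V ** matrix_inv A))"
      by (intro bounded_linear_minus bounded_linear_mm)
    show "norm (matrix_inv B - matrix_inv A - - (matrix_inv A ** (B - A) ** matrix_inv A)) / norm (B - A) \<le> H B"
      if "B \<noteq> A" "dist B A < e" for B
    proof -
      have "norm ((matrix_inv A - matrix_inv B) ** (B - A) ** matrix_inv A)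
          \<le> norm ((matrix_inv A - matrix_inv B) ** (B - A)) * norm (matrix_inv A) * K"
        by (rule K)
      also have "\<dots> \<le> norm (matrix_inv A - matrix_inv B) * norm (B - A) * K * norm (matrix_inv A) * K"
        using K by (intro mult_right_mono) auto
      finally show ?thesis
        unfolding eq[OF e(2)[OF that(2)]] H_def using that(1) by (simp add: divide_simps mult_ac)
    qed
    have "isCont matrix_inv A"
      using continuous_on_matrix_inv open_GL A continuous_on_eq_continuous_at by blast
    then have "matrix_inv \<midarrow>A\<rightarrow> matrix_inv A" by (simp add: isCont_def)
    then have "H \<midarrow>A\<rightarrow> norm (matrix_inv A - matrix_inv A) * K * norm (matrix_inv A) * K"
      unfolding H_def by (intro tendsto_intros)
    then show "H \<midarrow>A\<rightarrow> 0" by simp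
  qed
qed

lemma smooth_on_matrix_inv: "smooth_on GL (matrix_inv :: real^'n^'n \<Rightarrow> real^'n^'n)"
  unfolding smooth_on_def
proof
  fix k show "k_smooth_on k GL (matrix_inv :: real^'n^'n \<Rightarrow> real^'n^'n)"
  proof (induction k)
    case 0
    then show ?case by (simp add: continuous_on_matrix_inv)
  next
    case (Suc k)
    have "k_smooth_on k GL (\<lambda>A. - (matrix_inv A ** V ** matrix_inv A))" for V :: "real^'n^'n"
      by (intro k_smooth_on_linear[OF bounded_linear_minus[OF bounded_linear_ident]] open_GL
          k_smooth_on_bilinear[OF bounded_bilinear_mm] Suc k_smooth_on_const)
    then show ?case by (intro k_smooth_on_SucI[OF open_GL has_derivative_matrix_inv])
  qed
qed

lemma smooth_on_const: "open U \<Longrightarrow> smooth_on U (\<lambda>p. c)"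
  by (simp add: smooth_on_def k_smooth_on_const)

lemma smooth_on_add: "\<lbrakk>open U; smooth_on U f; smooth_on U g\<rbrakk> \<Longrightarrow> smooth_on U (\<lambda>p. f p + g p)"
  by (simp add: smooth_on_def k_smooth_on_add)

lemma smooth_on_linear:
  "\<lbrakk>bounded_linear h; open U; smooth_on U f\<rbrakk> \<Longrightarrow> smooth_on U (\<lambda>p. h (f p))"
  by (simp add: smooth_on_def k_smooth_on_linear)

lemma smooth_on_mm:
  fixes f g :: "real^'n^'n \<Rightarrow> real^'n^'n"
  shows "\<lbrakk>smooth_on GL f; smooth_on GL g\<rbrakk> \<Longrightarrow> smooth_on GL (\<lambda>p. f p ** g p)"
  by (simp add: smooth_on_def k_smooth_on_bilinear[OF bounded_bilinear_mm open_GL])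

lemma smooth_on_has_derivative:
  "\<lbrakk>smooth_on U f; p \<in> U\<rbrakk> \<Longrightarrow> (f has_derivative frechet_derivative f (at p)) (at p)"
  using smooth_onD(3) frechet_derivative_works by blast

lemma field_deriv_eq: "(f has_derivative f') (at p) \<Longrightarrow> field_deriv X f p = f' (X p)"
  by (simp add: field_deriv_def frechet_derivative_at[symmetric])

subsection \<open>The metric\<close>

lemma gl_metric_translate:
  fixes A V W :: "real^'n^'n"
  shows "gl_metric A V W = gl_metric (mat 1) (matrix_inv A ** V) (matrix_inv A ** W)"
proof -
  have "(mat 1 :: real^'n^'n) \<in> GL" by (auto simp: GL_def invertible_def intro!: exI[of _ "mat 1"])
  from GL_inv(1)[OF this] have "matrix_inv (mat 1) = (mat 1 :: real^'n^'n)" by simp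
  then show ?thesis by (simp add: gl_metric_def matrix_mul_assoc)
qed

lemma form_index_gl_metric:
  fixes A :: "real^'n^'n"
  assumes A: "A \<in> GL"
  shows "form_index (gl_metric A) = form_index (gl_metric (mat 1 :: real^'n^'n))"
proof -
  have I: "matrix_inv A \<in> GL" using GL_inv[OF A] by (auto simp: GL_def invertible_def)
  have *: "\<exists>S'. dim S = dim S' \<and> subspace S' \<and> (\<forall>v\<in>S'. v \<noteq> 0 \<longrightarrow> b' v v < 0)"
    if S: "subspace S" "\<forall>v\<in>S. v \<noteq> 0 \<longrightarrow> b v v < 0"
      and BC: "C ** B = mat 1" and eq: "\<And>v. b' (B ** v) (B ** v) = b v v"
    for S and B C :: "real^'n^'n" and b b' :: "real^'n^'n \<Rightarrow> real^'n^'n \<Rightarrow> real"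
  proof -
    have lin: "linear (\<lambda>V::real^'n^'n. B ** V)" by (intro linearI) (simp_all add: mm_lin)
    have inj: "inj (\<lambda>V::real^'n^'n. B ** V)"
      by (rule inj_on_inverseI[where g = "\<lambda>V::real^'n^'n. C ** V"]) (simp add: matrix_mul_assoc BC)
    have "dim ((\<lambda>V::real^'n^'n. B ** V) ` S) = dim S"
      by (rule dim_image_eq[OF lin]) (use inj in \<open>auto intro: inj_on_subset\<close>)
    moreover have "subspace ((\<lambda>V::real^'n^'n. B ** V) ` S)" by (rule linear_subspace_image[OF lin S(1)])
    moreover have "\<forall>v\<in>(\<lambda>V::real^'n^'n. B ** V) ` S. v \<noteq> 0 \<longrightarrow> b' v v < 0"
      using S(2) eq by (auto simp: linear_0[OF lin])
    ultimately show ?thesis by metis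
  qed
  have 1: "gl_metric (mat 1) (matrix_inv A ** v) (matrix_inv A ** v) = gl_metric A v v" for v
    by (simp add: gl_metric_translate[of A])
  have 2: "gl_metric A (A ** v) (A ** v) = gl_metric (mat 1) v v" for v
    by (simp add: gl_metric_translate[of A] matrix_mul_assoc GL_inv[OF A])
  have "{dim S | S. subspace S \<and> (\<forall>v\<in>S. v \<noteq> 0 \<longrightarrow> gl_metric A v v < 0)}
      = {dim S | S. subspace S \<and> (\<forall>v\<in>S. v \<noteq> 0 \<longrightarrow> gl_metric (mat 1 :: real^'n^'n) v v < 0)}"
    (is "?L = ?R")
  proof (intro equalityI subsetI)
    fix d assume "d \<in> ?L"
    then show "d \<in> ?R" using *[where b = "gl_metric A" and b' = "gl_metric (mat 1)", OF _ _ GL_inv(1)[OF A] 1] by blast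
  next
    fix d assume "d \<in> ?R"
    then show "d \<in> ?L" using *[where b = "gl_metric (mat 1)" and b' = "gl_metric A", OF _ _ GL_inv(2)[OF A] 2] by blast
  qed
  then show ?thesis by (simp add: form_index_def)
qed

lemma trace_transpose_self:
  "trace (V ** transpose V) = (\<Sum>i\<in>UNIV. \<Sum>j\<in>UNIV. (V $ i $ j)\<^sup>2)" for V :: "real^'n^'n"
  by (simp add: trace_def matrix_matrix_mult_def transpose_def power2_eq_square)

lemma semi_riemannian_gl_metric: "semi_riemannian_metric_on GL (gl_metric :: real^'n^'n \<Rightarrow> _)"
  unfolding semi_riemannian_metric_on_def
proof (intro conjI allI ballI)
  fix V W :: "real^'n^'n"
  show "smooth_on GL (\<lambda>p. gl_metric p V W)"
    unfolding gl_metric_def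
    by (intro smooth_on_linear[OF bounded_linear_trace] open_GL smooth_on_mm smooth_on_matrix_inv
        smooth_on_const)
next
  fix A V W :: "real^'n^'n"
  show "gl_metric A V W = gl_metric A W V"
    unfolding gl_metric_def using trace_mul_sym[of "matrix_inv A ** V" "matrix_inv A ** W"]
    by (simp add: matrix_mul_assoc)
next
  fix A :: "real^'n^'n"
  show "bilinear (gl_metric A)"
    unfolding bilinear_def gl_metric_def
    by (intro conjI allI linearI)
      (simp_all add: mm_lin linear_add[OF bounded_linear.linear[OF bounded_linear_trace]]
        linear_scale[OF bounded_linear.linear[OF bounded_linear_trace]])
next
  fix A V :: "real^'n^'n"
  assume A: "A \<in> GL"
  show "(\<forall>W. gl_metric A V W = 0) \<longrightarrow> V = 0"
  proof
    assume "\<forall>W. gl_metric A V W = 0"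
    then have "gl_metric A V (A ** transpose (matrix_inv A ** V)) = 0" by blast
    then have "trace ((matrix_inv A ** V) ** transpose (matrix_inv A ** V)) = 0"
      by (simp add: gl_metric_def matrix_mul_assoc[symmetric])
        (simp add: matrix_mul_assoc GL_inv[OF A])
    then have "(matrix_inv A ** V) $ i $ j = 0" for i j
      unfolding trace_transpose_self
      by (simp add: sum_nonneg_eq_0_iff sum_nonneg)
    then have "matrix_inv A ** V = 0" by (simp add: vec_eq_iff)
    then have "A ** matrix_inv A ** V = A ** 0" by (simp add: matrix_mul_assoc[symmetric])
    moreover have "A ** (0 :: real^'n^'n) = 0" by (simp add: vec_eq_iff matrix_matrix_mult_def)
    ultimately show "V = 0" by (simp add: GL_inv[OF A])
  qed
next
  show "\<exists>\<nu>. \<forall>p\<in>GL. form_index (gl_metric (p :: real^'n^'n)) = \<nu>"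
    using form_index_gl_metric by blast
qed

subsection \<open>Existence of the Levi-Civita connection\<close>

lemma levi_civita_gl_metric_exists:
  "\<exists>nabla :: (real^'n^'n) connection. levi_civita_connection_on GL gl_metric nabla"
proof -
  define G where "G P V W = (1/2) *\<^sub>R (V ** matrix_inv P ** W + W ** matrix_inv P ** V)"
    for P V W :: "real^'n^'n"
  define nabla :: "(real^'n^'n) connection" where "nabla X Y P = field_deriv X Y P - G P (X P) (Y P)" for X Y P
  have fl: "frechet_derivative Y (at p) (r *\<^sub>R u + s *\<^sub>R v)
      = r *\<^sub>R frechet_derivative Y (at p) u + s *\<^sub>R frechet_derivative Y (at p) v"
    if "smooth_on GL Y" "p \<in> GL" for Y :: "real^'n^'n \<Rightarrow> real^'n^'n" and p u v r s
    using linear_frechet_derivative[OF smooth_onD(3)[OF that]]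
    by (simp add: linear_add linear_scale)
  have "affine_connection_on GL nabla"
    unfolding affine_connection_on_def vector_fields_def
  proof (intro conjI ballI allI impI)
    fix X Y :: "real^'n^'n \<Rightarrow> real^'n^'n" assume X: "X \<in> {X. smooth_on GL X}" and Y: "Y \<in> {X. smooth_on GL X}"
    then have "smooth_on GL (\<lambda>P. field_deriv X Y P + (-1/2) *\<^sub>R (X P ** matrix_inv P ** Y P + Y P ** matrix_inv P ** X P))"
      by (intro smooth_on_add open_GL smooth_on_field_deriv smooth_on_mm smooth_on_matrix_inv
          smooth_on_linear[OF bounded_linear_scaleR_right]) auto
    then show "nabla X Y \<in> {X. smooth_on GL X}" by (simp add: nabla_def[abs_def] G_def)
  next
    fix f h :: "real^'n^'n \<Rightarrow> real" and X X' Y :: "real^'n^'n \<Rightarrow> real^'n^'n" and p :: "real^'n^'n"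
    assume "Y \<in> {X. smooth_on GL X}" "p \<in> GL"
    then show "nabla (\<lambda>q. f q *\<^sub>R X q + h q *\<^sub>R X' q) Y p = f p *\<^sub>R nabla X Y p + h p *\<^sub>R nabla X' Y p"
      by (simp add: nabla_def field_deriv_def fl G_def mm_lin algebra_simps)
  next
    fix a b :: real and X Y Y' :: "real^'n^'n \<Rightarrow> real^'n^'n" and p :: "real^'n^'n"
    assume "Y \<in> {X. smooth_on GL X}" "Y' \<in> {X. smooth_on GL X}" "p \<in> GL"
    then have "((\<lambda>q. a *\<^sub>R Y q + b *\<^sub>R Y' q) has_derivative
       (\<lambda>v. a *\<^sub>R frechet_derivative Y (at p) v + b *\<^sub>R frechet_derivative Y' (at p) v)) (at p)"
      by (auto intro!: derivative_eq_intros smooth_on_has_derivative)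
    from field_deriv_eq[OF this, of X]
    show "nabla X (\<lambda>q. a *\<^sub>R Y q + b *\<^sub>R Y' q) p = a *\<^sub>R nabla X Y p + b *\<^sub>R nabla X Y' p"
      by (simp add: nabla_def G_def mm_lin algebra_simps) (simp add: field_deriv_def)
  next
    fix f :: "real^'n^'n \<Rightarrow> real" and X Y :: "real^'n^'n \<Rightarrow> real^'n^'n" and p :: "real^'n^'n"
    assume "Y \<in> {X. smooth_on GL X}" "smooth_on GL f" "p \<in> GL"
    then have "((\<lambda>q. f q *\<^sub>R Y q) has_derivative
       (\<lambda>v. f p *\<^sub>R frechet_derivative Y (at p) v + frechet_derivative f (at p) v *\<^sub>R Y p)) (at p)"
      by (intro has_derivative_scaleR smooth_on_has_derivative) auto
    from field_deriv_eq[OF this, of X]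
    show "nabla X (\<lambda>q. f q *\<^sub>R Y q) p = field_deriv X f p *\<^sub>R Y p + f p *\<^sub>R nabla X Y p"
      by (simp add: nabla_def G_def mm_lin algebra_simps) (simp add: field_deriv_def)
  qed
  moreover have "torsion_free_on GL nabla"
    by (simp add: torsion_free_on_def nabla_def lie_bracket_def G_def add.commute)
  moreover have "metric_compatible_on GL gl_metric nabla"
    unfolding metric_compatible_on_def vector_fields_def
  proof (intro ballI, unfold mem_Collect_eq)
    fix X Y Z :: "real^'n^'n \<Rightarrow> real^'n^'n" and p :: "real^'n^'n"
    assume Y: "smooth_on GL Y" and Z: "smooth_on GL Z" and p: "p \<in> GL"
    let ?i = "matrix_inv p"
    let ?Y = "frechet_derivative Y (at p)" and ?Z = "frechet_derivative Z (at p)"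
    have tr: "trace (?i ** U ** ?i ** V ** ?i ** W) = trace (?i ** V ** ?i ** W ** ?i ** U)" for U V W
      using trace_mul_sym[of "?i ** U" "?i ** V ** ?i ** W"] by (simp add: matrix_mul_assoc)
    have "((\<lambda>q. gl_metric q (Y q) (Z q)) has_derivative
      (\<lambda>v. trace (matrix_inv p ** Y p ** matrix_inv p ** ?Z v
         + (matrix_inv p ** Y p ** (- (?i ** v ** ?i)) + (matrix_inv p ** ?Y v + (- (?i ** v ** ?i)) ** Y p) ** matrix_inv p) ** Z p))) (at p)"
      unfolding gl_metric_def
      by (intro bounded_linear.has_derivative[OF bounded_linear_trace]
          bounded_bilinear.FDERIV[OF bounded_bilinear_mm]
          has_derivative_matrix_inv p smooth_on_has_derivative[OF Y] smooth_on_has_derivative[OF Z])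
    from field_deriv_eq[OF this, of X]
    show "field_deriv X (\<lambda>q. gl_metric q (Y q) (Z q)) p
        = gl_metric p (nabla X Y p) (Z p) + gl_metric p (Y p) (nabla X Z p)"
      using tr[of "X p" "Y p" "Z p"] tr[of "Y p" "Z p" "X p"]
      by (simp add: gl_metric_def nabla_def G_def mm_lin matrix_mul_assoc field_deriv_def
          linear_add[OF bounded_linear.linear[OF bounded_linear_trace]]
          linear_diff[OF bounded_linear.linear[OF bounded_linear_trace]]
          linear_neg[OF bounded_linear.linear[OF bounded_linear_trace]]
          linear_scale[OF bounded_linear.linear[OF bounded_linear_trace]]) (simp add: field_simps)
  qed
  ultimately show ?thesis unfolding levi_civita_connection_on_def by blast
qed

end

(* The difference S X Y between an arbitrary Levi-Civita connection and
   D_X Y - (X P^-1 Y + Y P^-1 X) / 2 is symmetric because both are torsion-free, and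
   g (S X Y) Z is skew in Y and Z because both are metric; hence S = 0. Left invariance
   of the connection and its values on left-invariant fields are then read off this formula. *)

theory Submission
  imports Defs
begin

lemma smooth_on_cong:
  "\<lbrakk>open U; smooth_on U f; \<And>p. p \<in> U \<Longrightarrow> f p = g p\<rbrakk> \<Longrightarrow> smooth_on U g"
  unfolding smooth_on_def by (blast intro: k_smooth_on_cong)

lemma smooth_on_ident: "open U \<Longrightarrow> smooth_on U (\<lambda>p. p)"
  unfolding smooth_on_def
proof
  fix k assume U: "open U"
  show "k_smooth_on k U (\<lambda>p. p)"
  proof (cases k)
    case (Suc m)
    show ?thesis unfolding Suc
      by (rule k_smooth_on_SucI[OF U has_derivative_ident k_smooth_on_const[OF U]])
  qed simp
qed

lemma has_derivative_compose_linear: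
  assumes "bounded_linear L" "(f has_derivative f') (at (L p))"
  shows "((\<lambda>q. f (L q)) has_derivative (\<lambda>v. f' (L v))) (at p)"
  by (rule has_derivative_compose[OF bounded_linear_imp_has_derivative[OF assms(1)] assms(2)])

text \<open>A linear \<open>L\<close> is its own derivative, so differentiating \<open>f o L\<close>
  in direction \<open>v\<close> gives a derivative of \<open>f\<close> in the fixed direction
  \<open>L v\<close>, again composed with \<open>L\<close>. The induction therefore reproduces its
  own shape.\<close>

lemma k_smooth_on_compose_linear:
  assumes L: "bounded_linear L" and U: "open U" and LU: "\<And>p. p \<in> U \<Longrightarrow> L p \<in> V"
  shows "k_smooth_on k V f \<Longrightarrow> k_smooth_on k U (\<lambda>p. f (L p))"
proof (induction k arbitrary: f)
  case 0
  then have "continuous_on V f" by simp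
  then show ?case
    using continuous_on_compose2[OF _ bounded_linear.continuous_on[OF L continuous_on_id]] LU
    by (simp add: image_subset_iff) blast
next
  case (Suc k)
  show ?case
  proof (rule k_smooth_on_SucI[OF U, where f' = "\<lambda>p v. frechet_derivative f (at (L p)) (L v)"])
    show "((\<lambda>p. f (L p)) has_derivative (\<lambda>v. frechet_derivative f (at (L p)) (L v))) (at p)"
      if "p \<in> U" for p
      using Suc.prems LU[OF that]
      by (intro has_derivative_compose_linear[OF L]) (simp add: frechet_derivative_works)
    show "k_smooth_on k U (\<lambda>p. frechet_derivative f (at (L p)) (L v))" for v
      using Suc.prems by (intro Suc.IH) simp
  qed
qed

text \<open>Alternating the swaps of the first two and of the last two arguments, three times each,
  leads back to \<open>t x y z\<close> with sign (-1)^3.\<close>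

lemma symmetric_skew_trilinear_zero:
  fixes t :: "'a \<Rightarrow> 'a \<Rightarrow> 'a \<Rightarrow> real"
  assumes sym: "\<And>x y z. \<lbrakk>x \<in> F; y \<in> F; z \<in> F\<rbrakk> \<Longrightarrow> t x y z = t y x z"
    and skew: "\<And>x y z. \<lbrakk>x \<in> F; y \<in> F; z \<in> F\<rbrakk> \<Longrightarrow> t x y z = - t x z y"
    and "x \<in> F" "y \<in> F" "z \<in> F"
  shows "t x y z = 0"
  using sym[of x y z] skew[of y x z] sym[of y z x] skew[of z y x] sym[of z x y] skew[of x z y] assms(3-)
  by simp

lemma GL_mult:
  assumes "A \<in> GL" "B \<in> GL"
  shows "A ** B \<in> GL"
  using assms invertible_mult by (auto simp: GL_def)

lemma mat_1_in_GL: "mat 1 \<in> GL"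
  by (auto simp: GL_def invertible_def intro!: exI[of _ "mat 1"])

lemma matrix_inv_in_GL: "A \<in> GL \<Longrightarrow> matrix_inv A \<in> GL"
  using GL_inv by (auto simp: GL_def invertible_def)

lemma matrix_inv_left_translate:
  fixes B P :: "real^'n^'n"
  assumes "B \<in> GL" "P \<in> GL"
  shows "matrix_inv (matrix_inv B ** P) = matrix_inv P ** B"
proof -
  let ?Q = "matrix_inv B ** P"
  have "?Q \<in> GL" using assms by (intro GL_mult matrix_inv_in_GL)
  have "matrix_inv P ** B ** ?Q = matrix_inv P ** (B ** matrix_inv B) ** P"
    by (simp add: matrix_mul_assoc)
  also have "\<dots> = mat 1" by (simp add: GL_inv assms)
  finally have "matrix_inv P ** B ** (?Q ** matrix_inv ?Q) = matrix_inv ?Q"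
    by (simp add: matrix_mul_assoc)
  then show ?thesis using GL_inv(1)[OF \<open>?Q \<in> GL\<close>] by simp
qed

lemmas trace_lin =
  linear_add[OF bounded_linear.linear[OF bounded_linear_trace]]
  linear_diff[OF bounded_linear.linear[OF bounded_linear_trace]]
  linear_neg[OF bounded_linear.linear[OF bounded_linear_trace]]
  linear_scale[OF bounded_linear.linear[OF bounded_linear_trace]]

text \<open>The subtracted term is minus the Christoffel form of \<open>gl_metric\<close> in the
  ambient coordinates. The formula is that of the witness in
  \<open>levi_civita_gl_metric_exists\<close>, here available as a constant.\<close>

definition gl_nabla :: "(real^'n^'n) connection" where
  "gl_nabla X Y P = field_deriv X Y P
     - (1/2) *\<^sub>R (X P ** matrix_inv P ** Y P + Y P ** matrix_inv P ** X P)"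

text \<open>Differentiating the two inverses yields two triple traces with a minus sign. The
  correction terms of \<open>gl_nabla\<close> yield four such traces with coefficient 1/2, which are
  pairwise equal by cyclicity of the trace.\<close>

lemma field_deriv_gl_metric:
  fixes X Y Z :: "real^'n^'n \<Rightarrow> real^'n^'n"
  assumes Y: "smooth_on GL Y" and Z: "smooth_on GL Z" and p: "p \<in> GL"
  shows "field_deriv X (\<lambda>q. gl_metric q (Y q) (Z q)) p
    = gl_metric p (gl_nabla X Y p) (Z p) + gl_metric p (Y p) (gl_nabla X Z p)"
proof -
  let ?i = "matrix_inv p"
  have cyc: "trace (?i ** U ** ?i ** V ** ?i ** W) = trace (?i ** V ** ?i ** W ** ?i ** U)" for U V W
    using trace_mul_sym[of "?i ** U" "?i ** V ** ?i ** W"] by (simp add: matrix_mul_assoc)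
  \<comment> \<open>The nesting follows the product rule applied to the left-associated product
    under the trace.\<close>
  have "((\<lambda>q. gl_metric q (Y q) (Z q)) has_derivative
    (\<lambda>v. trace (?i ** Y p ** ?i ** frechet_derivative Z (at p) v
       + (?i ** Y p ** (- (?i ** v ** ?i))
         + (?i ** frechet_derivative Y (at p) v + (- (?i ** v ** ?i)) ** Y p) ** ?i) ** Z p))) (at p)"
    unfolding gl_metric_def
    by (intro bounded_linear.has_derivative[OF bounded_linear_trace]
        bounded_bilinear.FDERIV[OF bounded_bilinear_mm]
        has_derivative_matrix_inv p smooth_on_has_derivative[OF Y] smooth_on_has_derivative[OF Z])
  from field_deriv_eq[OF this, of X] show ?thesis
    using cyc[of "X p" "Y p" "Z p"] cyc[of "Y p" "Z p" "X p"]
    by (simp add: gl_metric_def gl_nabla_def mm_lin matrix_mul_assoc field_deriv_def trace_lin)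
      (simp add: field_simps)
qed

text \<open>Stated for all smooth fields, since left invariance of a connection concerns more than
  left-invariant fields.\<close>

lemma levi_civita_eq_gl_nabla:
  fixes nabla :: "(real^'n^'n) connection"
  assumes LC: "levi_civita_connection_on GL gl_metric nabla"
    and X: "smooth_on GL X" and Y: "smooth_on GL Y" and p: "p \<in> GL"
  shows "nabla X Y p = gl_nabla X Y p"
proof -
  let ?F = "{X. smooth_on GL X} :: (real^'n^'n \<Rightarrow> real^'n^'n) set"
  let ?S = "\<lambda>X Y. nabla X Y p - gl_nabla X Y p"
  \<comment> \<open>The point \<open>p\<close> is fixed, but the arguments remain fields:
    torsion-freeness and metric compatibility are identities between fields.\<close>
  define t where "t X Y Z = gl_metric p (?S X Y) (Z p)" for X Y Z
  have bil: "bilinear (gl_metric p)"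
    and sym: "\<And>v w. gl_metric p v w = gl_metric p w v"
    and nondeg: "\<And>v. (\<And>w. gl_metric p v w = 0) \<Longrightarrow> v = 0"
    using semi_riemannian_gl_metric p unfolding semi_riemannian_metric_on_def by blast+
  have "?S X Y = ?S Y X" if "X \<in> ?F" "Y \<in> ?F" for X Y
  proof -
    have "nabla X Y p - nabla Y X p = lie_bracket X Y p"
      using LC that p
      by (simp add: levi_civita_connection_on_def torsion_free_on_def vector_fields_def)
    also have "\<dots> = gl_nabla X Y p - gl_nabla Y X p"
      by (simp add: gl_nabla_def lie_bracket_def add.commute)
    finally show ?thesis by (simp add: algebra_simps)
  qed
  then have 1: "t X Y Z = t Y X Z" if "X \<in> ?F" "Y \<in> ?F" "Z \<in> ?F" for X Y Z
    unfolding t_def using that(1,2) by (intro arg_cong2[where f = "gl_metric p"] refl)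
  have 2: "t X Y Z = - t X Z Y" if "X \<in> ?F" "Y \<in> ?F" "Z \<in> ?F" for X Y Z
  proof -
    have "field_deriv X (\<lambda>q. gl_metric q (Y q) (Z q)) p
        = gl_metric p (nabla X Y p) (Z p) + gl_metric p (Y p) (nabla X Z p)"
      using LC that p
      by (simp add: levi_civita_connection_on_def metric_compatible_on_def vector_fields_def)
    \<comment> \<open>Both connections give the same derivative of the metric, so subtraction leaves
      g (S X Y) Z + g Y (S X Z) = 0.\<close>
    then show ?thesis
      using field_deriv_gl_metric[of Y Z p X] that p sym[of "Y p"]
      by (simp add: t_def bilinear_lsub[OF bil])
  qed
  \<comment> \<open>Each tangent vector \<open>w\<close> at \<open>p\<close> is the value of a
    smooth field, namely the constant one, so nondegeneracy at \<open>p\<close> becomes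
    applicable.\<close>
  have "gl_metric p (?S X Y) w = 0" for w
    using symmetric_skew_trilinear_zero[of ?F t X Y "\<lambda>_. w", OF 1 2] X Y
    by (simp add: t_def smooth_on_const open_GL)
  then have "?S X Y = 0" by (rule nondeg)
  then show ?thesis by simp
qed

lemma bounded_linear_mm_right: "bounded_linear (\<lambda>V :: real^'n^'n. A ** V)" for A :: "real^'n^'n"
  by (rule bounded_bilinear.bounded_linear_right[OF bounded_bilinear_mm])

lemma smooth_on_left_push:
  fixes B :: "real^'n^'n"
  assumes B: "B \<in> GL" and X: "smooth_on GL X"
  shows "smooth_on GL (left_push B X)"
proof -
  have "smooth_on GL (\<lambda>P. X (matrix_inv B ** P))"
    using X k_smooth_on_compose_linear[OF bounded_linear_mm_right open_GL
        GL_mult[OF matrix_inv_in_GL[OF B]]]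
    unfolding smooth_on_def by blast
  then show ?thesis
    unfolding left_push_def[abs_def] by (rule smooth_on_linear[OF bounded_linear_mm_right open_GL])
qed

text \<open>By the chain rule the direction \<open>B ** X ?Q\<close> is multiplied by
  \<open>matrix_inv B\<close> before the derivative of \<open>Y\<close> at \<open>?Q\<close> acts on
  it, and the two factors cancel.\<close>

lemma field_deriv_left_push:
  fixes B :: "real^'n^'n"
  assumes B: "B \<in> GL" and Y: "smooth_on GL Y" and P: "P \<in> GL"
  shows "field_deriv (left_push B X) (left_push B Y) P = left_push B (field_deriv X Y) P"
proof -
  let ?Q = "matrix_inv B ** P"
  have Q: "?Q \<in> GL" by (intro GL_mult matrix_inv_in_GL B P)
  have "(left_push B Y has_derivative
      (\<lambda>v. B ** frechet_derivative Y (at ?Q) (matrix_inv B ** v))) (at P)"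
    unfolding left_push_def[abs_def]
    by (intro bounded_linear.has_derivative[OF bounded_linear_mm_right]
        has_derivative_compose_linear[OF bounded_linear_mm_right] smooth_on_has_derivative[OF Y Q])
  from field_deriv_eq[OF this, of "left_push B X"] show ?thesis
    by (simp add: left_push_def field_deriv_def matrix_mul_assoc GL_inv[OF B])
qed

text \<open>With Q = B^-1 P one has P^-1 B = Q^-1, so the correction term (B X_Q) P^-1 (B Y_Q)
  equals B (X_Q Q^-1 Y_Q), and likewise with X and Y exchanged.\<close>

lemma gl_nabla_left_push:
  fixes B :: "real^'n^'n"
  assumes B: "B \<in> GL" and Y: "smooth_on GL Y" and P: "P \<in> GL"
  shows "gl_nabla (left_push B X) (left_push B Y) P = left_push B (gl_nabla X Y) P"
  by (simp add: gl_nabla_def field_deriv_left_push[OF B Y P])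
    (simp add: left_push_def gl_nabla_def matrix_inv_left_translate[OF B P] mm_lin matrix_mul_assoc)

lemma left_invariant_has_derivative:
  assumes X: "X \<in> left_invariant_fields" and P: "P \<in> GL"
  shows "(X has_derivative (\<lambda>v. v ** X (mat 1))) (at P)"
proof (rule has_derivative_transform_within_open[OF _ open_GL P])
  show "((\<lambda>P. P ** X (mat 1)) has_derivative (\<lambda>v. v ** X (mat 1))) (at P)"
    by (intro bounded_linear_imp_has_derivative bounded_bilinear.bounded_linear_left[OF bounded_bilinear_mm])
qed (use X in \<open>simp add: left_invariant_fields_def\<close>)

lemma smooth_on_left_invariant:
  assumes "X \<in> left_invariant_fields"
  shows "smooth_on GL X"
proof (rule smooth_on_cong[OF open_GL])
  show "smooth_on GL (\<lambda>P. P ** X (mat 1))"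
    by (intro smooth_on_mm smooth_on_ident smooth_on_const open_GL)
qed (use assms in \<open>simp add: left_invariant_fields_def\<close>)

lemma field_deriv_left_invariant:
  assumes X: "X \<in> left_invariant_fields" and Y: "Y \<in> left_invariant_fields" and P: "P \<in> GL"
  shows "field_deriv X Y P = P ** X (mat 1) ** Y (mat 1)"
  using field_deriv_eq[OF left_invariant_has_derivative[OF Y P], of X] X P
  by (simp add: left_invariant_fields_def)

text \<open>This is the identification of the Lie algebra of \<open>GL\<close> with matrices under
  the commutator; it shows that the bracket is again left-invariant.\<close>

lemma lie_bracket_left_invariant:
  assumes "X \<in> left_invariant_fields" "Y \<in> left_invariant_fields" "P \<in> GL"
  shows "lie_bracket X Y P = P ** (X (mat 1) ** Y (mat 1) - Y (mat 1) ** X (mat 1))"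
  using assms by (simp add: lie_bracket_def field_deriv_left_invariant mm_lin matrix_mul_assoc)

text \<open>With x and y the values at the identity, the derivative part is P x y and the correction
  is half of P x y + P y x, which leaves half the commutator.\<close>

lemma gl_nabla_left_invariant:
  fixes P :: "real^'n^'n"
  assumes X: "X \<in> left_invariant_fields" and Y: "Y \<in> left_invariant_fields" and P: "P \<in> GL"
  shows "gl_nabla X Y P = (1/2) *\<^sub>R lie_bracket X Y P"
proof -
  let ?x = "X (mat 1)" and ?y = "Y (mat 1)"
  have "X P = P ** ?x" "Y P = P ** ?y" using X Y P by (auto simp: left_invariant_fields_def)
  moreover have "P ** a ** matrix_inv P ** (P ** b) = P ** a ** b" for a b :: "real^'n^'n"
  proof -
    have "P ** a ** matrix_inv P ** (P ** b) = P ** a ** (matrix_inv P ** P) ** b"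
      by (simp only: matrix_mul_assoc)
    then show ?thesis by (simp add: GL_inv[OF P])
  qed
  moreover have "a - (1/2) *\<^sub>R (a + b) = (1/2) *\<^sub>R (a - b)" for a b :: "real^'n^'n"
    by (simp add: vec_eq_iff field_simps)
  ultimately show ?thesis
    by (simp add: gl_nabla_def field_deriv_left_invariant[OF X Y P] lie_bracket_def
        field_deriv_left_invariant[OF Y X P])
qed

theorem corollary2p1:
  fixes nabla :: "(real^'n^'n) connection"
  assumes "levi_civita_connection_on GL gl_metric nabla"
  shows "(\<forall>X\<in>left_invariant_fields. \<forall>Y\<in>left_invariant_fields.
            (\<forall>P\<in>GL. nabla X Y P = (1/2) *\<^sub>R lie_bracket X Y P) \<and>
            nabla X Y \<in> left_invariant_fields) \<and>
         cartan_schouten_zero_connection nabla"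
proof -
  note eq = levi_civita_eq_gl_nabla[OF assms]
  have half: "nabla X Y P = (1/2) *\<^sub>R lie_bracket X Y P"
    if "X \<in> left_invariant_fields" "Y \<in> left_invariant_fields" "P \<in> GL" for X Y P
    using that by (simp add: eq smooth_on_left_invariant gl_nabla_left_invariant)
  have "nabla X Y \<in> left_invariant_fields"
    if "X \<in> left_invariant_fields" "Y \<in> left_invariant_fields" for X Y
  proof -
    have "nabla X Y P = P ** nabla X Y (mat 1)" if "P \<in> GL" for P
      using half[OF \<open>X \<in> _\<close> \<open>Y \<in> _\<close>] lie_bracket_left_invariant[OF \<open>X \<in> _\<close> \<open>Y \<in> _\<close>]
      by (simp add: that mat_1_in_GL mm_lin)
    then show ?thesis by (simp add: left_invariant_fields_def)
  qed
  moreover have "left_invariant_connection nabla"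
    unfolding left_invariant_connection_def vector_fields_def
  proof (intro ballI, unfold mem_Collect_eq)
    fix B P :: "real^'n^'n" and X Y :: "real^'n^'n \<Rightarrow> real^'n^'n"
    assume B: "B \<in> GL" and P: "P \<in> GL" and X: "smooth_on GL X" and Y: "smooth_on GL Y"
    have "nabla (left_push B X) (left_push B Y) P = left_push B (gl_nabla X Y) P"
      by (simp add: eq smooth_on_left_push B P X Y gl_nabla_left_push)
    \<comment> \<open>Here \<open>eq\<close> is used for \<open>X\<close> and \<open>Y\<close>
      themselves, at the translated point \<open>matrix_inv B ** P\<close>, which lies in
      \<open>GL\<close>.\<close>
    also have "\<dots> = left_push B (nabla X Y) P"
      by (simp add: left_push_def eq X Y GL_mult matrix_inv_in_GL B P)
    finally show "nabla (left_push B X) (left_push B Y) P = left_push B (nabla X Y) P" .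
  qed
  moreover have "affine_connection_on GL nabla"
    using assms by (simp add: levi_civita_connection_on_def)
  ultimately show ?thesis using half by (auto simp: cartan_schouten_zero_connection_def)
qed

end
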